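(* Let $q$ be a prime power. If there exists an $((n,K,R,d))_q$ Clifford subsystem code with $K>1$, then there exists an $((n+1,K,R,\ge d))_q$ subsystem code that is pure to $1$.
   Context: Let $p$ be the characteristic of $\mathbf{F}_q$. For $(x|y)\in\mathbf{F}_q^{2n}$ (with $x,y\in\mathbf{F}_q^n$), $\mathrm{swt}(x|y)$ is the number of $i$ with $(x_i,y_i)\ne(0,0)$, and $\mathrm{swt}(S)$ is the minimum of $\mathrm{swt}$ over the nonzero elements of $S$. The trace-symplectic product of $(a|b)$ and $(a'|b')$ is $\mathrm{tr}_{q/p}(a'\cdot b-a\cdot b')$, and $C^{\perp_s}$ is the dual of $C\subseteq\mathbf{F}_q^{2n}$ with respect to it. All subsystem codes are Clifford subsystem codes: an $((n,K,R,d))_q$ subsystem code is a subspace $Q=A\otimes B$ of $\mathbf{C}^{q^n}$, $\dim A=K$, $\dim B=R$, arising from an additive code; concretely, its existence means that there is an additive subgroup $C\le\mathbf{F}_q^{2n}$ (the zero code is allowed) with $D=C\cap C^{\perp_s}$ such that $|C|=q^nR/K$, $|D|=q^n/(KR)$, and $d=\mathrm{swt}(D^{\perp_s}\setminus C)$ if $D^{\perp_s}\ne C$, while $d=\mathrm{swt}(D^{\perp_s})$ if $D^{\perp_s}=C$ (the case $K=1$). Writing $\ge d$ in the last position means that the minimum distance is some $\tilde d\ge d$. The code derived from $C$ is pure to $d'$ if $C$ contains no nonzero element of symplectic weight less than $d'$. *)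

theory Defs
  imports
    "HOL-Library.Cardinality"
    "HOL-Computational_Algebra.Computational_Algebra"
    "HOL-Algebra.Group"
    "Jordan_Normal_Form.Matrix"
begin

text \<open>
  The field with \<open>q\<close> elements is a type \<open>'a :: finite_field\<close> with \<open>q = CARD('a)\<close>; its
  characteristic is \<open>p = CHAR('a)\<close>. A vector \<open>(x|y)\<close> of length \<open>2n\<close> over this field is the pair
  \<open>(x, y)\<close> in \<open>carrier_vec n \<times> carrier_vec n\<close>.
\<close>

definition symp_group :: "'a::monoid_add itself \<Rightarrow> nat \<Rightarrow> ('a vec \<times> 'a vec) monoid" where
  "symp_group ty n = monoid_vec ty n \<times>\<times> monoid_vec ty n"

definition swt :: "'a::zero vec \<times> 'a vec \<Rightarrow> nat" where
  "swt v = card {i. i < dim_vec (fst v) \<and> (fst v $ i, snd v $ i) \<noteq> (0, 0)}"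

definition swt_set :: "nat \<Rightarrow> ('a::zero vec \<times> 'a vec) set \<Rightarrow> nat" where
  "swt_set n S = Min (swt ` (S - {(0\<^sub>v n, 0\<^sub>v n)}))"

text \<open>
  The absolute trace, as the sum of the conjugates \<open>x ^ (p ^ i)\<close> for \<open>i < m\<close> where \<open>q = p ^ m\<close>.
  It takes its values in the prime subfield, here regarded as a subset of \<open>'a\<close>.
\<close>

definition field_trace :: "'a::finite_field \<Rightarrow> 'a" where
  "field_trace x = (\<Sum>i<multiplicity CHAR('a) CARD('a). x ^ (CHAR('a) ^ i))"

definition trace_symp ::
    "'a::finite_field vec \<times> 'a vec \<Rightarrow> 'a vec \<times> 'a vec \<Rightarrow> 'a" where
  "trace_symp u v = field_trace (fst v \<bullet> snd u - fst u \<bullet> snd v)"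

definition symp_dual ::
    "nat \<Rightarrow> ('a::finite_field vec \<times> 'a vec) set \<Rightarrow> ('a vec \<times> 'a vec) set" where
  "symp_dual n C =
     {v \<in> carrier_vec n \<times> carrier_vec n. \<forall>u\<in>C. trace_symp u v = 0}"

text \<open>
  \<open>clifford_subsystem_code n K R d C\<close>: the additive code \<open>C\<close> gives rise to an
  \<open>((n, K, R, d))\<close> Clifford subsystem code over the field \<open>'a\<close>.
\<close>

definition clifford_subsystem_code ::
    "nat \<Rightarrow> nat \<Rightarrow> nat \<Rightarrow> nat \<Rightarrow> ('a::finite_field vec \<times> 'a vec) set \<Rightarrow> bool" where
  "clifford_subsystem_code n K R d C \<longleftrightarrow>
     K \<ge> 1 \<and> R \<ge> 1 \<and>
     subgroup C (symp_group TYPE('a) n) \<and>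
     (let D = C \<inter> symp_dual n C in
        real (card C) = real CARD('a) ^ n * real R / real K \<and>
        real (card D) = real CARD('a) ^ n / (real K * real R) \<and>
        d = (if symp_dual n D \<noteq> C then swt_set n (symp_dual n D - C)
             else swt_set n (symp_dual n D)))"

definition pure_to :: "nat \<Rightarrow> nat \<Rightarrow> ('a::zero vec \<times> 'a vec) set \<Rightarrow> bool" where
  "pure_to n d' C \<longleftrightarrow> (\<forall>c\<in>C. c \<noteq> (0\<^sub>v n, 0\<^sub>v n) \<longrightarrow> \<not> swt c < d')"

end

theory Submission
  imports Defs "HOL-Algebra.Sylow" "Berlekamp_Zassenhaus.Berlekamp_Type_Based"
begin

text \<open>
  Append to every codeword of \<open>C\<close> a coordinate pair \<open>(a, 0)\<close> with \<open>a\<close> arbitrary. By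
  nondegeneracy of the trace this operation commutes with the symplectic dual, so it replaces
  \<open>C\<close>, \<open>D\<close> and \<open>D\<^sup>\<bottom>\<close> by their extensions, multiplying the cardinalities by \<open>q\<close>, and it
  does not decrease weights in \<open>D\<^sup>\<bottom> - C\<close>. The new pairs have weight one and lie in \<open>D\<^sup>\<bottom>\<close>, so
  the case \<open>D\<^sup>\<bottom> = C\<close> has to be excluded: it gives
  \<open>q ^ (2 * n) \<le> card D * card C = q ^ (2 * n) / K\<^sup>2\<close>, contradicting \<open>K > 1\<close>.
\<close>

section \<open>The trace of a finite field\<close>

text \<open>If a prime \<open>l\<close> divides \<open>q\<close>, Sylow's theorem gives a subgroup
  of order \<open>l\<close> in the additive group; a nonzero \<open>x\<close> in it satisfies
  \<open>l * x = 0\<close>, so the characteristic divides \<open>l\<close> and equals it. Thus the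
  exponent used in \<open>field_trace\<close> is the \<open>m\<close> with
  \<open>q = p ^ m\<close>.\<close>

lemma card_finite_field_eq_CHAR_power:
  "CARD('a::finite_field) = CHAR('a) ^ multiplicity CHAR('a) CARD('a)"
proof -
  let ?p = "CHAR('a)" and ?q = "CARD('a)"
  \<comment> \<open>The additive group of the field in multiplicative notation, the form in which
    Sylow's theorem is stated; powers in it are the multiples \<open>of_nat k * x\<close>.\<close>
  define G where "G = \<lparr>carrier = (UNIV :: 'a set), monoid.mult = (+), one = (0 :: 'a)\<rparr>"
  interpret G: group G
  proof (rule groupI)
    fix x assume "x \<in> carrier G"
    show "\<exists>y\<in>carrier G. y \<otimes>\<^bsub>G\<^esub> x = \<one>\<^bsub>G\<^esub>"
      by (intro bexI[of _ "-x"]) (auto simp: G_def)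
  qed (auto simp: G_def add_ac)
  have pow: "x [^]\<^bsub>G\<^esub> k = of_nat k * x" for x :: 'a and k :: nat
    by (induction k) (auto simp: G_def algebra_simps)
  have "l = ?p" if l: "prime l" "l dvd ?q" for l
  proof (rule ccontr)
    assume "l \<noteq> ?p"
    obtain m where m: "?q = l ^ 1 * m"
      using l by (auto elim: dvdE)
    have "\<exists>H. subgroup H G \<and> card H = l ^ 1"
      by (rule sylow_thm[OF l(1) G.is_group, of 1 m]) (use m in \<open>auto simp: order_def G_def\<close>)
    then obtain H where H: "subgroup H G" "card H = l" by auto
    have "\<not> H \<subseteq> {0}"
      using H(2) prime_gt_1_nat[OF l(1)] card_mono[of "{0}" H] by auto
    then obtain x where x: "x \<in> H" "x \<noteq> 0" by auto
    interpret H: group "G\<lparr>carrier := H\<rparr>"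
      using H(1) G.is_group by (rule subgroup.subgroup_is_group)
    have "x [^]\<^bsub>G\<lparr>carrier := H\<rparr>\<^esub> order (G\<lparr>carrier := H\<rparr>) = \<one>\<^bsub>G\<lparr>carrier := H\<rparr>\<^esub>"
      by (rule H.pow_order_eq_1) (use x in auto)
    hence "of_nat l * x = 0"
      using pow[of x l] by (simp add: order_def H(2) G_def nat_pow_def)
    hence "?p dvd l"
      using x by (simp add: of_nat_eq_0_iff_char_dvd)
    with l(1) \<open>l \<noteq> ?p\<close> show False
      using CHAR_prime[where ?'a = 'a] primes_dvd_imp_eq by blast
  qed
  hence "prime_factors ?q \<subseteq> {?p}" by (auto simp: prime_factors_dvd)
  \<comment> \<open>The inclusion is enough: a prime outside \<open>prime_factors ?q\<close> has
    multiplicity 0 and contributes the factor 1.\<close>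
  hence "(\<Prod>l\<in>prime_factors ?q. l ^ multiplicity l ?q) = (\<Prod>l\<in>{?p}. l ^ multiplicity l ?q)"
    by (intro prod.mono_neutral_left) (auto simp: prime_factors_multiplicity)
  thus ?thesis
    using prime_factorization_nat[of ?q] by simp
qed

lemma field_trace_add:
  "field_trace (x + y) = field_trace x + field_trace (y :: 'a::finite_field)"
  by (simp add: field_trace_def freshmans_dream' sum.distrib)

lemma field_trace_0 [simp]: "field_trace (0 :: 'a::finite_field) = 0"
  by (simp add: field_trace_def)

text \<open>Frobenius permutes the conjugates cyclically because \<open>x ^ (p ^ m) = x\<close>. So
  trace values are roots of \<open>X ^ p - X\<close>, that is, elements of the prime
  subfield.\<close>

lemma field_trace_power_CHAR:
  "field_trace x ^ CHAR('a) = field_trace (x :: 'a::finite_field)"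
proof -
  let ?p = "CHAR('a)" and ?m = "multiplicity CHAR('a) CARD('a)"
  have "field_trace x ^ ?p = (\<Sum>i<?m. x ^ (?p ^ Suc i))"
    by (simp add: field_trace_def freshmans_dream_sum mult.commute flip: power_mult)
  moreover have "x ^ (?p ^ ?m) = x ^ (?p ^ 0)"
    using card_finite_field_eq_CHAR_power[where ?'a = 'a] finite_field_power_card_eq_same[of x]
    by simp
  ultimately show ?thesis
    unfolding field_trace_def
    using sum.lessThan_Suc_shift[of "\<lambda>i. x ^ (?p ^ i)" ?m] by simp
qed

text \<open>The trace is a nonzero polynomial of degree \<open>p ^ (m - 1) < q\<close>, so it does not vanish
  everywhere.\<close>

lemma field_trace_nondegenerate:
  fixes b :: "'a::finite_field"
  assumes "\<And>a. field_trace (a * b) = 0"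
  shows "b = 0"
proof (rule ccontr)
  assume b: "b \<noteq> 0"
  let ?p = "CHAR('a)" and ?m = "multiplicity CHAR('a) CARD('a)"
  have p: "?p > 1" by (rule prime_gt_1_nat) auto
  have q: "CARD('a) = ?p ^ ?m" by (rule card_finite_field_eq_CHAR_power)
  have "CARD('a) \<noteq> 1"
    using card_mono[of UNIV "{0, 1 :: 'a}"] by simp
  with q have m: "?m > 0" by (cases "?m = 0") auto
  define P where "P = (\<Sum>i<?m. monom (1::'a) (?p ^ i))"
  \<comment> \<open>Since \<open>b\<close> is nonzero, every \<open>x\<close> has the form
    \<open>a * b\<close>.\<close>
  have "poly P x = 0" for x
    using assms[of "x / b"] b by (simp add: P_def poly_sum poly_monom field_trace_def)
  hence "CARD('a) = card {x. poly P x = 0}" by simp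
  also have "\<dots> \<le> degree P"
  proof (rule card_poly_roots_bound)
    \<comment> \<open>Only \<open>i = 0\<close> gives the exponent \<open>p ^ i = 1\<close>, and
      this term is present because \<open>m > 0\<close>.\<close>
    have "coeff P 1 = (\<Sum>i<?m. if i = 0 then 1 else 0)"
      unfolding P_def coeff_sum using p by (intro sum.cong) auto
    also have "\<dots> = 1" using m by simp
    finally show "P \<noteq> 0" by auto
  qed
  also have "degree P \<le> ?p ^ (?m - 1)"
    unfolding P_def
  proof (rule degree_sum_le)
    fix i assume "i \<in> {..<?m}"
    hence "?p ^ i \<le> ?p ^ (?m - 1)" using p by (intro power_increasing) auto
    thus "degree (monom (1::'a) (?p ^ i)) \<le> ?p ^ (?m - 1)" by (simp add: degree_monom_eq)
  qed auto
  also have "\<dots> < ?p ^ ?m" using p m by (intro power_strict_increasing) auto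
  finally show False using q by simp
qed

section \<open>Annihilators in finite groups\<close>

text \<open>The set consists of roots of \<open>X ^ p - X\<close>. The bound limits how many values
  an additive map into the prime subfield can take.\<close>

lemma card_prime_subfield_le: "card {x :: 'a::finite_field. x ^ CHAR('a) = x} \<le> CHAR('a)"
proof -
  let ?p = "CHAR('a)"
  have p: "?p > 1" by (rule prime_gt_1_nat) auto
  define P where "P = monom (1::'a) ?p - monom 1 1"
  have "coeff P ?p = 1" using p by (simp add: P_def)
  hence "card {x. poly P x = 0} \<le> degree P" by (intro card_poly_roots_bound) auto
  also have "degree P \<le> ?p"
    unfolding P_def using p by (intro degree_diff_le) (auto simp: degree_monom_eq)
  finally show ?thesis by (simp add: P_def poly_monom)
qed

context group
begin

lemma additive_map_one:
  fixes f :: "'a \<Rightarrow> 'c::ab_group_add"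
  assumes "\<And>x y. x \<in> carrier G \<Longrightarrow> y \<in> carrier G \<Longrightarrow> f (x \<otimes> y) = f x + f y"
  shows "f \<one> = 0"
  using assms[of \<one> \<one>] by simp

lemma additive_map_inv:
  fixes f :: "'a \<Rightarrow> 'c::ab_group_add"
  assumes "\<And>x y. x \<in> carrier G \<Longrightarrow> y \<in> carrier G \<Longrightarrow> f (x \<otimes> y) = f x + f y"
    and "x \<in> carrier G"
  shows "f (inv x) = - f x"
  using assms(1)[of "inv x" x] assms(2) additive_map_one[of f, OF assms(1)]
  by (simp add: eq_neg_iff_add_eq_0)

text \<open>The group is the union of at most \<open>p\<close> fibres, and each nonempty fibre is a
  translate of the kernel.\<close>

lemma card_le_CHAR_mult_card_kernel:
  fixes f :: "'a \<Rightarrow> 'c::finite_field"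
  assumes "finite (carrier G)"
    and add: "\<And>x y. x \<in> carrier G \<Longrightarrow> y \<in> carrier G \<Longrightarrow> f (x \<otimes> y) = f x + f y"
    and prime_field: "\<And>x. x \<in> carrier G \<Longrightarrow> f x ^ CHAR('c) = f x"
  shows "card (carrier G) \<le> CHAR('c) * card {x \<in> carrier G. f x = 0}"
proof -
  let ?ker = "{x \<in> carrier G. f x = 0}" and ?F = "{c :: 'c. c ^ CHAR('c) = c}"
  have fibre: "card {x \<in> carrier G. f x = c} \<le> card ?ker" for c
  proof (cases "{x \<in> carrier G. f x = c} = {}")
    case False
    then obtain z where z: "z \<in> carrier G" "f z = c" by auto
    show ?thesis
    proof (rule card_inj_on_le[of "\<lambda>x. inv z \<otimes> x"])
      show "inj_on (\<lambda>x. inv z \<otimes> x) {x \<in> carrier G. f x = c}"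
        using z by (auto simp: inj_on_def)
      show "(\<lambda>x. inv z \<otimes> x) ` {x \<in> carrier G. f x = c} \<subseteq> ?ker"
        using z by (auto simp: add additive_map_inv[of f, OF add])
    qed (use assms(1) in auto)
  qed (simp only: card.empty)
  have "carrier G = (\<Union>c\<in>?F. {x \<in> carrier G. f x = c})"
    using prime_field by auto
  also have "card \<dots> \<le> (\<Sum>c\<in>?F. card {x \<in> carrier G. f x = c})"
    by (rule card_UN_le) auto
  also have "\<dots> \<le> card ?F * card ?ker"
    using sum_bounded_above[of ?F "\<lambda>c. card {x \<in> carrier G. f x = c}" "card ?ker"] fibre by simp
  also have "\<dots> \<le> CHAR('c) * card ?ker"
    by (intro mult_right_mono card_prime_subfield_le) auto
  finally show ?thesis .
qed

text \<open>The cosets of the kernel through \<open>z [^] j\<close> for \<open>j < p\<close> are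
  pairwise disjoint, because \<open>f\<close> takes the distinct values
  \<open>of_nat j * f z\<close> on them.\<close>

lemma CHAR_mult_card_kernel_le:
  fixes f :: "'a \<Rightarrow> 'c::finite_field"
  assumes "finite (carrier G)"
    and add: "\<And>x y. x \<in> carrier G \<Longrightarrow> y \<in> carrier G \<Longrightarrow> f (x \<otimes> y) = f x + f y"
    and z: "z \<in> carrier G" "f z \<noteq> 0"
  shows "CHAR('c) * card {x \<in> carrier G. f x = 0} \<le> card (carrier G)"
proof -
  let ?ker = "{x \<in> carrier G. f x = 0}"
  have pow: "f (z [^] k) = of_nat k * f z" for k :: nat
    by (induction k) (auto simp: add z additive_map_one[of f, OF add] algebra_simps)
  have "card ({..<CHAR('c)} \<times> ?ker) \<le> card (carrier G)"
  proof (rule card_inj_on_le[of "\<lambda>(j, x). z [^] j \<otimes> x"])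
    show "inj_on (\<lambda>(j, x). z [^] j \<otimes> x) ({..<CHAR('c)} \<times> ?ker)"
    proof (rule inj_onI)
      fix u w
      assume "u \<in> {..<CHAR('c)} \<times> ?ker" "w \<in> {..<CHAR('c)} \<times> ?ker"
        and eq: "(case u of (j, x) \<Rightarrow> z [^] j \<otimes> x) = (case w of (j, x) \<Rightarrow> z [^] j \<otimes> x)"
      then obtain i j x y where uw: "u = (i, x)" "w = (j, y)"
        and *: "i < CHAR('c)" "j < CHAR('c)" "x \<in> carrier G" "y \<in> carrier G" "f x = 0" "f y = 0"
        by auto
      have eq': "z [^] i \<otimes> x = z [^] j \<otimes> y" using eq by (simp add: uw)
      have "f (z [^] i \<otimes> x) = f (z [^] j \<otimes> y)" using eq' by simp
      hence "of_nat i * f z = of_nat j * f z"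
        using * z(1) by (simp add: add pow del: mult_cancel_right)
      hence "of_nat i = (of_nat j :: 'c)"
        using z(2) by simp
      hence "i = j"
        using * by (simp add: of_nat_eq_iff_cong_CHAR cong_def)
      thus "u = w" using uw * eq' z(1) by simp
    qed
  qed (use z assms(1) in auto)
  thus ?thesis by (simp add: card_cartesian_product)
qed

lemma subgroup_annihilator:
  fixes B :: "'a \<Rightarrow> 'a \<Rightarrow> 'c::ab_group_add"
  assumes C: "subgroup C G"
    and add: "\<And>u x y. u \<in> carrier G \<Longrightarrow> x \<in> carrier G \<Longrightarrow> y \<in> carrier G
               \<Longrightarrow> B u (x \<otimes> y) = B u x + B u y"
  shows "subgroup {v \<in> C. \<forall>u\<in>C. B u v = 0} G"
proof -
  interpret C: subgroup C G by fact
  have "B u \<one> = 0" if "u \<in> C" for u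
    using additive_map_one[of "B u"] add that by auto
  moreover have "B u (inv x) = - B u x" if "u \<in> C" "x \<in> C" for u x
    using additive_map_inv[of "B u" x] add that by auto
  ultimately show ?thesis
    by (intro subgroupI) (auto simp: add intro!: exI[of _ \<one>])
qed

text \<open>Count the pairs \<open>(u, v) \<in> D \<times> G\<close> with \<open>B u v = 0\<close>: a row \<open>u\<close>
  contains at least a fraction \<open>1 / p\<close> of all \<open>v\<close>, a column \<open>v\<close> outside of the annihilator at
  most a fraction \<open>1 / p\<close> of all \<open>u\<close>.\<close>

lemma card_le_card_mult_card_annihilator:
  fixes B :: "'a \<Rightarrow> 'a \<Rightarrow> 'c::finite_field"
  assumes fin: "finite (carrier G)" and D: "subgroup D G"
    and addl: "\<And>x y v. x \<in> carrier G \<Longrightarrow> y \<in> carrier G \<Longrightarrow> v \<in> carrier G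
                \<Longrightarrow> B (x \<otimes> y) v = B x v + B y v"
    and addr: "\<And>u x y. u \<in> carrier G \<Longrightarrow> x \<in> carrier G \<Longrightarrow> y \<in> carrier G
                \<Longrightarrow> B u (x \<otimes> y) = B u x + B u y"
    and prime_field: "\<And>u v. u \<in> carrier G \<Longrightarrow> v \<in> carrier G \<Longrightarrow> B u v ^ CHAR('c) = B u v"
  shows "card (carrier G) \<le> card D * card {v \<in> carrier G. \<forall>u\<in>D. B u v = 0}"
proof -
  interpret D: subgroup D G by fact
  interpret DG: group "G\<lparr>carrier := D\<rparr>"
    using D is_group by (rule subgroup.subgroup_is_group)
  let ?p = "CHAR('c)" and ?V = "carrier G"
  let ?A = "{v \<in> ?V. \<forall>u\<in>D. B u v = 0}"
  have p: "?p > 1" by (rule prime_gt_1_nat) auto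
  have finD: "finite D" using fin D.subset finite_subset by blast
  define N where "N = (\<Sum>u\<in>D. card {v \<in> ?V. B u v = 0})"
  have N': "N = (\<Sum>v\<in>?V. card {u \<in> D. B u v = 0})"
    unfolding N_def by (rule sum_multicount_gen) (use fin finD in auto)
  have one: "B \<one> v = 0" if "v \<in> ?V" for v
    using additive_map_one[of "\<lambda>u. B u v"] addl that by auto
  \<comment> \<open>The row of the identity is full, which is better than the fraction
    \<open>1 / p\<close>; it is split off so that its contribution \<open>p * card ?V\<close> is
    kept.\<close>
  have "?p * card ?V + (card D - 1) * card ?V = ?p * card ?V + (\<Sum>u\<in>D - {\<one>}. card ?V)"
    using finD by simp
  also have "\<dots> \<le> ?p * card {v \<in> ?V. B \<one> v = 0}
                   + (\<Sum>u\<in>D - {\<one>}. ?p * card {v \<in> ?V. B u v = 0})"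
  proof (intro add_mono sum_mono)
    have "{v \<in> ?V. B \<one> v = 0} = ?V" using one by auto
    thus "?p * card ?V \<le> ?p * card {v \<in> ?V. B \<one> v = 0}" by simp
    show "card ?V \<le> ?p * card {v \<in> ?V. B u v = 0}" if "u \<in> D - {\<one>}" for u
      by (rule card_le_CHAR_mult_card_kernel) (use that fin addr prime_field in auto)
  qed
  also have "\<dots> = ?p * N"
    unfolding N_def
    using sum.remove[OF finD D.one_closed, of "\<lambda>u. card {v \<in> ?V. B u v = 0}"]
    by (simp add: sum_distrib_left distrib_left)
  also have "\<dots> = (\<Sum>v\<in>?V. ?p * card {u \<in> D. B u v = 0})"
    by (simp add: N' sum_distrib_left)
  also have "\<dots> \<le> (\<Sum>v\<in>?V. if v \<in> ?A then ?p * card D else card D)"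
  proof (rule sum_mono)
    fix v assume v: "v \<in> ?V"
    show "?p * card {u \<in> D. B u v = 0} \<le> (if v \<in> ?A then ?p * card D else card D)"
    proof (cases "v \<in> ?A")
      case True
      thus ?thesis using finD by (auto intro!: card_mono)
    next
      case False
      then obtain z where "z \<in> D" "B z v \<noteq> 0" using v by auto
      hence "?p * card {u \<in> D. B u v = 0} \<le> card D"
        using DG.CHAR_mult_card_kernel_le[of "\<lambda>u. B u v" z] finD addl v by auto
      thus ?thesis using False by (simp only: if_False)
    qed
  qed
  also have "\<dots> = card ?A * (?p * card D) + card (?V - ?A) * card D"
  proof -
    have "?V \<inter> {v. v \<in> ?A} = ?A" "?V \<inter> - {v. v \<in> ?A} = ?V - ?A" by auto
    thus ?thesis using fin by (simp only: sum.If_cases) simp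
  qed
  finally have le: "?p * card ?V + (card D - 1) * card ?V
      \<le> card ?A * (?p * card D) + card (?V - ?A) * card D" .
  \<comment> \<open>Writing \<open>card D\<close> and \<open>p\<close> as successors removes
    truncated subtraction. With \<open>?V\<close> split into \<open>?A\<close> and its complement,
    the estimate becomes
    \<open>(p - 1) * card ?V \<le> (p - 1) * (card D * card ?A)\<close>.\<close>
  have "card D \<noteq> 0" using finD D.one_closed by (metis card_0_eq empty_iff)
  then obtain e where e: "card D = Suc e" by (cases "card D") auto
  obtain p' where p': "?p = Suc p'" "p' > 0" using p by (cases "?p") auto
  have "card ?V = card ?A + card (?V - ?A)"
    using card_Un_disjoint[of ?A "?V - ?A"] fin by (simp add: Un_absorb1)
  with le have "p' * card ?V \<le> p' * (card D * card ?A)"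
    by (simp add: e p' algebra_simps)
  thus ?thesis using p' by simp
qed

end

section \<open>The trace-symplectic form\<close>

lemma group_symp_group: "group (symp_group TYPE('a::ab_group_add) n)"
  unfolding symp_group_def
  using comm_group_vec[where ?'a = 'a] by (intro DirProd_group) (auto simp: comm_group_def)

lemma carrier_symp_group: "carrier (symp_group TYPE('a::monoid_add) n) = carrier_vec n \<times> carrier_vec n"
  by (simp add: symp_group_def monoid_vec_simps)

lemma mult_symp_group:
  "u \<otimes>\<^bsub>symp_group TYPE('a::monoid_add) n\<^esub> v = (fst u + fst v, snd u + snd v)"
  by (simp add: symp_group_def monoid_vec_simps mult_DirProd')

lemma one_symp_group: "\<one>\<^bsub>symp_group TYPE('a::monoid_add) n\<^esub> = (0\<^sub>v n, 0\<^sub>v n)"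
  by (simp add: symp_group_def monoid_vec_simps)

lemma card_carrier_symp_group:
  "card (carrier (symp_group TYPE('a::{monoid_add,finite}) n)) = CARD('a) ^ (2 * n)"
  by (simp add: carrier_symp_group card_cartesian_product card_carrier_vec mult_2 power_add)

lemma finite_carrier_symp_group: "finite (carrier (symp_group TYPE('a::{monoid_add,finite}) n))"
  by (simp add: carrier_symp_group)

lemma trace_symp_add_left:
  fixes v x y :: "'a::finite_field vec \<times> 'a vec"
  assumes "v \<in> carrier (symp_group TYPE('a) n)" "x \<in> carrier (symp_group TYPE('a) n)"
    "y \<in> carrier (symp_group TYPE('a) n)"
  shows "trace_symp (x \<otimes>\<^bsub>symp_group TYPE('a) n\<^esub> y) v = trace_symp x v + trace_symp y v"
proof -
  obtain v1 v2 x1 x2 y1 y2 where "v = (v1, v2)" "x = (x1, x2)" "y = (y1, y2)"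
    "{v1, v2, x1, x2, y1, y2} \<subseteq> carrier_vec n"
    using assms by (auto simp: carrier_symp_group)
  thus ?thesis
    by (simp add: trace_symp_def mult_symp_group scalar_prod_add_distrib[of _ n]
        add_scalar_prod_distrib[of _ n] algebra_simps flip: field_trace_add)
qed

lemma trace_symp_add_right:
  fixes v x y :: "'a::finite_field vec \<times> 'a vec"
  assumes "v \<in> carrier (symp_group TYPE('a) n)" "x \<in> carrier (symp_group TYPE('a) n)"
    "y \<in> carrier (symp_group TYPE('a) n)"
  shows "trace_symp v (x \<otimes>\<^bsub>symp_group TYPE('a) n\<^esub> y) = trace_symp v x + trace_symp v y"
proof -
  obtain v1 v2 x1 x2 y1 y2 where "v = (v1, v2)" "x = (x1, x2)" "y = (y1, y2)"
    "{v1, v2, x1, x2, y1, y2} \<subseteq> carrier_vec n"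
    using assms by (auto simp: carrier_symp_group)
  thus ?thesis
    by (simp add: trace_symp_def mult_symp_group scalar_prod_add_distrib[of _ n]
        add_scalar_prod_distrib[of _ n] algebra_simps flip: field_trace_add)
qed

text \<open>Swapping the arguments negates the form, so orthogonality is symmetric although
  \<open>symp_dual\<close> fixes an order of the arguments.\<close>

lemma trace_symp_commute_eq_0:
  assumes "u \<in> carrier_vec n \<times> carrier_vec n" "v \<in> carrier_vec n \<times> carrier_vec n"
    "trace_symp u v = 0"
  shows "trace_symp v u = 0"
proof -
  have "fst v \<bullet> snd u = snd u \<bullet> fst v" "fst u \<bullet> snd v = snd v \<bullet> fst u"
    using assms by (auto intro!: comm_scalar_prod[of _ n])
  thus ?thesis
    using assms(3) field_trace_add[of "fst v \<bullet> snd u - fst u \<bullet> snd v" "fst u \<bullet> snd v - fst v \<bullet> snd u"]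
    by (simp add: trace_symp_def)
qed

lemma trace_symp_power_CHAR:
  "trace_symp u v ^ CHAR('a) = trace_symp u (v :: 'a::finite_field vec \<times> 'a vec)"
  by (simp add: trace_symp_def field_trace_power_CHAR)

lemma subgroup_inter_symp_dual:
  fixes C :: "('a::finite_field vec \<times> 'a vec) set"
  assumes "subgroup C (symp_group TYPE('a) n)"
  shows "subgroup (C \<inter> symp_dual n C) (symp_group TYPE('a) n)"
proof -
  have "C \<inter> symp_dual n C = {v \<in> C. \<forall>u\<in>C. trace_symp u v = 0}"
    using subgroup.subset[OF assms] by (auto simp: symp_dual_def carrier_symp_group)
  moreover have "subgroup \<dots> (symp_group TYPE('a) n)"
    using assms by (intro group.subgroup_annihilator[OF group_symp_group])
      (auto simp: trace_symp_add_right)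
  ultimately show ?thesis by simp
qed

text \<open>The counting bound applies because the form is biadditive with values in the prime
  subfield. This is the half of the dual cardinality formula that rules out
  \<open>symp_dual n D = C\<close>.\<close>

lemma card_mult_card_symp_dual_ge:
  fixes D :: "('a::finite_field vec \<times> 'a vec) set"
  assumes "subgroup D (symp_group TYPE('a) n)"
  shows "CARD('a) ^ (2 * n) \<le> card D * card (symp_dual n D)"
proof -
  have "card (carrier (symp_group TYPE('a) n)) \<le>
      card D * card {v \<in> carrier (symp_group TYPE('a) n). \<forall>u\<in>D. trace_symp u v = 0}"
    using assms
    by (intro group.card_le_card_mult_card_annihilator[OF group_symp_group])
      (auto simp: finite_carrier_symp_group trace_symp_add_left trace_symp_add_right
        trace_symp_power_CHAR)
  thus ?thesis
    by (simp add: card_carrier_symp_group) (simp add: carrier_symp_group symp_dual_def)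
qed

section \<open>Extending a code by one free coordinate\<close>

text \<open>The new pair is put in front, so an old position \<open>i\<close> becomes
  \<open>Suc i\<close>.\<close>

definition extend_vec :: "'a::zero \<Rightarrow> 'a vec \<times> 'a vec \<Rightarrow> 'a vec \<times> 'a vec" where
  "extend_vec a v = (vCons a (fst v), vCons 0 (snd v))"

definition extend_code :: "('a::zero vec \<times> 'a vec) set \<Rightarrow> ('a vec \<times> 'a vec) set" where
  "extend_code C = {extend_vec a v | a v. v \<in> C}"

lemma extend_vec_inject [simp]: "extend_vec a v = extend_vec b w \<longleftrightarrow> a = b \<and> v = w"
  by (auto simp: extend_vec_def prod_eq_iff)

lemma extend_vec_zero: "extend_vec 0 (0\<^sub>v n, 0\<^sub>v n) = (0\<^sub>v (Suc n), 0\<^sub>v (Suc n))"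
  by (simp add: extend_vec_def zero_vec_Suc)

lemma extend_vec_in_extend_code [simp]: "extend_vec a v \<in> extend_code C \<longleftrightarrow> v \<in> C"
  by (simp add: extend_code_def del: split_paired_Ex)

lemma extend_code_Int: "extend_code (A \<inter> B) = extend_code A \<inter> extend_code B"
  by (auto simp: extend_code_def)

lemma card_extend_code:
  "card (extend_code C) = CARD('a::{zero,finite}) * card (C :: ('a vec \<times> 'a vec) set)"
proof -
  have "extend_code C = (\<lambda>(a, v). extend_vec a v) ` (UNIV \<times> C)"
    by (force simp: extend_code_def image_iff)
  also have "card \<dots> = card ((UNIV :: 'a set) \<times> C)"
    by (intro card_image) (auto simp: inj_on_def)
  finally show ?thesis by (simp add: card_cartesian_product)
qed

text \<open>\<open>extend_vec\<close> is additive in \<open>a\<close> and \<open>v\<close> jointly,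
  so products and inverses are computed separately in the new coordinate and in
  \<open>C\<close>.\<close>

lemma subgroup_extend_code:
  fixes C :: "('a::ab_group_add vec \<times> 'a vec) set"
  assumes "subgroup C (symp_group TYPE('a) n)"
  shows "subgroup (extend_code C) (symp_group TYPE('a) (Suc n))" (is "subgroup _ ?G'")
proof -
  let ?G = "symp_group TYPE('a) n"
  interpret G: group ?G by (rule group_symp_group)
  interpret G': group ?G' by (rule group_symp_group)
  interpret C: subgroup C ?G by fact
  have vCons_add: "vCons a v + vCons b w = vCons (a + b) (v + w)"
    if "v \<in> carrier_vec n" "w \<in> carrier_vec n" for a b :: 'a and v w
    using that by (intro eq_vecI) (auto simp: vec_index_vCons)
  have comp: "fst v \<in> carrier_vec n" "snd v \<in> carrier_vec n" if "v \<in> C" for v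
    using C.subset that by (auto simp: carrier_symp_group)
  have carr: "extend_vec a v \<in> carrier ?G'" if "v \<in> C" for a v
    using comp that by (simp add: extend_vec_def carrier_symp_group)
  have mult: "extend_vec a v \<otimes>\<^bsub>?G'\<^esub> extend_vec b w = extend_vec (a + b) (v \<otimes>\<^bsub>?G\<^esub> w)"
    if "v \<in> C" "w \<in> C" for a b v w
    using that comp by (simp add: extend_vec_def mult_symp_group vCons_add)
  have inv: "inv\<^bsub>?G'\<^esub> extend_vec a v = extend_vec (- a) (inv\<^bsub>?G\<^esub> v)" if "v \<in> C" for a v
  proof (rule G'.inv_equality)
    have "v \<in> carrier ?G" using that C.subset by auto
    thus "extend_vec (- a) (inv\<^bsub>?G\<^esub> v) \<otimes>\<^bsub>?G'\<^esub> extend_vec a v = \<one>\<^bsub>?G'\<^esub>"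
      using that by (subst mult) (auto simp: one_symp_group extend_vec_def zero_vec_Suc)
  qed (use that carr in auto)
  show ?thesis
  proof (rule G'.subgroupI)
    show "extend_code C \<subseteq> carrier ?G'"
      using carr by (auto simp only: extend_code_def)
    show "extend_code C \<noteq> {}"
      using extend_vec_in_extend_code[of 0 "\<one>\<^bsub>?G\<^esub>" C] C.one_closed by blast
  next
    fix x assume "x \<in> extend_code C"
    then obtain a v where "x = extend_vec a v" "v \<in> C"
      unfolding extend_code_def by blast
    thus "inv\<^bsub>?G'\<^esub> x \<in> extend_code C" by (simp add: inv)
  next
    fix x y assume "x \<in> extend_code C" "y \<in> extend_code C"
    then obtain a v b w where "x = extend_vec a v" "v \<in> C" "y = extend_vec b w" "w \<in> C"
      unfolding extend_code_def by blast
    thus "x \<otimes>\<^bsub>?G'\<^esub> y \<in> extend_code C" by (simp add: mult)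
  qed
qed

text \<open>The second entry of the new pair \<open>(a, 0)\<close> annihilates \<open>b\<close>, so
  the new coordinate contributes only the product of \<open>a\<close> and \<open>c\<close>.\<close>

lemma trace_symp_extend_vec:
  "trace_symp (extend_vec a u) (vCons b x, vCons c y)
     = trace_symp u (x, y) - field_trace (a * c)"
proof -
  have "trace_symp (extend_vec a u) (vCons b x, vCons c y) + field_trace (a * c) = trace_symp u (x, y)"
    by (simp add: trace_symp_def extend_vec_def algebra_simps flip: field_trace_add)
  thus ?thesis by (simp add: algebra_simps)
qed

text \<open>In one coordinate, the pairs \<open>(a, 0)\<close> form a set that is its own
  trace-symplectic dual. Hence the free coordinate of the code reappears as a free coordinate of the
  dual.\<close>

lemma symp_dual_extend_code:
  fixes C :: "('a::finite_field vec \<times> 'a vec) set"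
  assumes C0: "(0\<^sub>v n, 0\<^sub>v n) \<in> C"
  shows "symp_dual (Suc n) (extend_code C) = extend_code (symp_dual n C)"
proof (intro equalityI subsetI)
  fix w assume w: "w \<in> symp_dual (Suc n) (extend_code C)"
  obtain b x c y where w_eq: "w = (vCons b x, vCons c y)"
    and xy: "x \<in> carrier_vec n" "y \<in> carrier_vec n"
  proof -
    obtain w1 w2 where *: "w = (w1, w2)" "w1 \<in> carrier_vec (Suc n)" "w2 \<in> carrier_vec (Suc n)"
      using w by (auto simp: symp_dual_def)
    thus ?thesis
      by (cases w1; cases w2) (auto simp: that)
  qed
  have orth: "trace_symp u (x, y) - field_trace (a * c) = 0" if "u \<in> C" for a u
    using w that by (simp add: symp_dual_def w_eq flip: trace_symp_extend_vec[of a u b])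
  \<comment> \<open>The extensions of the zero codeword isolate the new coordinate and force
    \<open>c = 0\<close>. Afterwards \<open>a = 0\<close> isolates the old coordinates.\<close>
  have "trace_symp (0\<^sub>v n, 0\<^sub>v n) (x, y) = 0"
    using xy by (simp add: trace_symp_def)
  hence "field_trace (a * c) = 0" for a
    using orth[OF C0, of a] by simp
  hence "c = 0" by (rule field_trace_nondegenerate)
  moreover have "(x, y) \<in> symp_dual n C"
    using orth[of _ 0] xy by (auto simp: symp_dual_def)
  ultimately show "w \<in> extend_code (symp_dual n C)"
    by (auto simp: w_eq extend_code_def extend_vec_def)
next
  fix w assume "w \<in> extend_code (symp_dual n C)"
  then obtain b v where w: "w = extend_vec b v" "v \<in> symp_dual n C"
    by (auto simp: extend_code_def)
  have "trace_symp (extend_vec a u) w = 0" if "u \<in> C" for a u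
    using w that trace_symp_extend_vec[of a u b "fst v" 0 "snd v"]
    by (auto simp: symp_dual_def extend_vec_def)
  thus "w \<in> symp_dual (Suc n) (extend_code C)"
    using w by (auto simp: symp_dual_def extend_code_def) (auto simp: extend_vec_def)
qed

text \<open>Shifting by \<open>Suc\<close> embeds the old support into the new one.\<close>

lemma swt_extend_vec_ge: "swt v \<le> swt (extend_vec a v)"
  unfolding swt_def
proof (rule card_inj_on_le[of Suc])
  show "Suc ` {i. i < dim_vec (fst v) \<and> (fst v $ i, snd v $ i) \<noteq> (0, 0)}
    \<subseteq> {i. i < dim_vec (fst (extend_vec a v)) \<and>
          (fst (extend_vec a v) $ i, snd (extend_vec a v) $ i) \<noteq> (0, 0)}"
    by (auto simp: extend_vec_def vec_index_vCons)
qed auto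

text \<open>A vector of weight 0 has no nonzero entry, and the carrier condition fixes both lengths
  to \<open>n\<close>, so it is the zero vector.\<close>

lemma pure_to_1:
  assumes "C \<subseteq> carrier_vec n \<times> carrier_vec n"
  shows "pure_to n 1 C"
  unfolding pure_to_def
proof (intro ballI impI notI)
  fix c assume c: "c \<in> C" "c \<noteq> (0\<^sub>v n, 0\<^sub>v n)" "swt c < 1"
  have "{i. i < dim_vec (fst c) \<and> (fst c $ i, snd c $ i) \<noteq> (0, 0)} = {}"
    using c(3) by (simp add: swt_def)
  hence "fst c = 0\<^sub>v n" "snd c = 0\<^sub>v n"
    using assms c(1) by (auto intro!: eq_vecI)
  with c(2) show False by (simp add: prod_eq_iff)
qed

theorem theorem24:
  fixes n K R d :: nat
  assumes "\<exists>C :: ('a::finite_field vec \<times> 'a vec) set. clifford_subsystem_code n K R d C"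
    and "K > 1"
  shows "\<exists>(C' :: ('a vec \<times> 'a vec) set) d'.
           d' \<ge> d \<and> clifford_subsystem_code (n + 1) K R d' C' \<and> pure_to (n + 1) 1 C'"
proof -
  obtain C :: "('a vec \<times> 'a vec) set" where C: "clifford_subsystem_code n K R d C"
    using assms(1) by auto
  let ?q = "CARD('a)"
  define D where "D = C \<inter> symp_dual n C"
  let ?E = "symp_dual n D"
  have sub: "subgroup C (symp_group TYPE('a) n)" and K: "K \<ge> 1" and R: "R \<ge> 1"
    and cardC: "real (card C) = real ?q ^ n * real R / real K"
    and cardD: "real (card D) = real ?q ^ n / (real K * real R)"
    and d: "d = (if ?E \<noteq> C then swt_set n (?E - C) else swt_set n ?E)"
    using C unfolding clifford_subsystem_code_def Let_def D_def by auto
  have Csub: "C \<subseteq> carrier_vec n \<times> carrier_vec n"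
    using subgroup.subset[OF sub] by (simp add: carrier_symp_group)
  have C0: "(0\<^sub>v n, 0\<^sub>v n) \<in> C"
    using subgroup.one_closed[OF sub] by (simp add: one_symp_group)
  have subD: "subgroup D (symp_group TYPE('a) n)"
    unfolding D_def by (rule subgroup_inter_symp_dual[OF sub])
  have D0: "(0\<^sub>v n, 0\<^sub>v n) \<in> D"
    using subgroup.one_closed[OF subD] by (simp add: one_symp_group)
  \<comment> \<open>Every element of \<open>D\<close> is orthogonal to all of \<open>C\<close>, and
    orthogonality is symmetric. Together with \<open>neq\<close> this makes \<open>?E - C\<close>
    nonempty, so the new minimum is taken over a nonempty set.\<close>
  have CE: "C \<subseteq> ?E"
    using Csub trace_symp_commute_eq_0[of _ n] unfolding D_def symp_dual_def by blast
  have neq: "?E \<noteq> C"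
  proof
    assume "?E = C"
    hence "?q ^ (2 * n) \<le> card D * card C"
      using card_mult_card_symp_dual_ge[OF subD] by simp
    hence "real ?q ^ (2 * n) \<le> real (card D) * real (card C)"
      by (metis of_nat_le_iff of_nat_mult of_nat_power)
    \<comment> \<open>The factor \<open>R\<close> cancels between the two cardinalities, whereas
      \<open>K\<close> divides both.\<close>
    also have "\<dots> = real ?q ^ (2 * n) / (real K) ^ 2"
      using K R by (simp add: cardC cardD field_simps power2_eq_square mult_2_right power_add)
    finally have "real K ^ 2 \<le> 1"
      using K by (simp add: field_simps)
    moreover have "1 ^ 2 < real K ^ 2"
      using \<open>K > 1\<close> by (intro power_strict_mono) auto
    ultimately show False by simp
  qed
  define C' where "C' = extend_code C"
  define D' where "D' = C' \<inter> symp_dual (Suc n) C'"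
  have D': "D' = extend_code D"
    unfolding D'_def C'_def D_def by (simp add: symp_dual_extend_code[OF C0] extend_code_Int)
  have E': "symp_dual (Suc n) D' = extend_code ?E"
    unfolding D' by (rule symp_dual_extend_code[OF D0])
  have E_ne: "?E - C \<noteq> {}" using CE neq by auto
  then obtain v where v: "v \<in> ?E - C" by blast
  have neq': "symp_dual (Suc n) D' \<noteq> C'"
    using v unfolding E' C'_def by (metis DiffD1 DiffD2 extend_vec_in_extend_code)
  have finE: "finite ?E"
    by (rule finite_subset[of _ "carrier_vec n \<times> carrier_vec n"]) (auto simp: symp_dual_def)
  define S' where "S' = symp_dual (Suc n) D' - C' - {(0\<^sub>v (Suc n), 0\<^sub>v (Suc n))}"
  have "d \<le> swt_set (Suc n) (symp_dual (Suc n) D' - C')"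
    unfolding swt_set_def S'_def[symmetric]
  proof (rule Min.boundedI)
    have "S' \<subseteq> carrier_vec (Suc n) \<times> carrier_vec (Suc n)"
      by (auto simp: S'_def symp_dual_def)
    thus "finite (swt ` S')" by (intro finite_imageI) (rule finite_subset, auto)
    \<comment> \<open>This vector is nonzero: \<open>v\<close> lies outside \<open>C\<close>, which
      contains the zero vector.\<close>
    have "extend_vec 0 v \<in> S'"
      using v C0 by (auto simp: S'_def E' C'_def simp flip: extend_vec_zero)
    thus "swt ` S' \<noteq> {}" by auto
    fix k assume "k \<in> swt ` S'"
    then obtain a u where u: "u \<in> ?E - C" "k = swt (extend_vec a u)"
      unfolding S'_def E' C'_def extend_code_def by blast
    \<comment> \<open>Likewise \<open>u\<close> is nonzero, so its weight takes part in the minimum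
      defining \<open>d\<close>.\<close>
    have "d \<le> swt u"
      using neq u(1) C0 finE unfolding d swt_set_def by (auto intro!: Min_le)
    also have "\<dots> \<le> k" using swt_extend_vec_ge u(2) by simp
    finally show "d \<le> k" .
  qed
  \<comment> \<open>Extension multiplies both cardinalities by \<open>q\<close>, which turns
    \<open>q ^ n\<close> into \<open>q ^ (n + 1)\<close> with the same \<open>K\<close> and
    \<open>R\<close>; \<open>neq'\<close> selects the first case of the distance.\<close>
  moreover have "clifford_subsystem_code (n + 1) K R (swt_set (Suc n) (symp_dual (Suc n) D' - C')) C'"
    using neq' subgroup_extend_code[OF sub] cardC cardD K R
    unfolding clifford_subsystem_code_def Let_def D'_def
    by (simp flip: D'_def add: D' card_extend_code) (simp add: C'_def card_extend_code)
  moreover have "pure_to (n + 1) 1 C'"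
    using Csub by (intro pure_to_1) (auto simp: C'_def extend_code_def extend_vec_def)
  ultimately show ?thesis by blast
qed

end
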